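(* For any integers $L\ge 3$ and $M\ge L$, there exists a four-coloring $f$ of the triangulation $T(3L,3M)$ of the torus with $\deg(f)\equiv 6\pmod{12}$. Consequently, the zero-temperature Wang--Swendsen--Kotecký (WSK) dynamics for four-colorings of $T(3L,3M)$ is non-ergodic.
   Context: The triangulation $T(r,s)$ of the torus has vertex set $\mathbb{Z}/r\mathbb{Z}\times\mathbb{Z}/s\mathbb{Z}$; edges join $(x,y)$ to $(x+1,y)$, $(x,y+1)$ and $(x+1,y+1)$; triangles are $\{(x,y),(x+1,y),(x+1,y+1)\}$ and $\{(x,y),(x,y+1),(x+1,y+1)\}$. A four-coloring is a proper vertex coloring with colors $\{1,2,3,4\}$. Its degree: regard $f$ as a non-degenerate simplicial map to the boundary $\partial\Delta^3$ of the tetrahedron with vertices $1,2,3,4$; fix orientations of the torus and of $\partial\Delta^3$. For a triangle $\tau$ of $\partial\Delta^3$ let $p$ (resp. $n$) be the number of triangles of $T$ mapped onto $\tau$ with orientation preserved (resp. reversed). Then $\deg(f)=p-n$, independent of $\tau$ and, up to sign, of the orientations. Zero-temperature WSK dynamics with $q$ colors on a graph $G$: the Markov chain on proper $q$-colorings which at each step chooses uniformly at random two distinct colors $a,b$ and then, independently for each connected component of the subgraph induced by the vertices colored $a$ or $b$, with probability $1/2$ interchanges $a$ and $b$ on it, otherwise leaves it unchanged. Ergodic means irreducible (every state can eventually be reached from every other state). *)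

theory Defs
  imports "HOL-Probability.Probability" "HOL-Number_Theory.Cong"
begin

type_synonym vertex = "int \<times> int"

(* The group Z/rZ x Z/sZ is represented by the residues {0..<r} x {0..<s}; "translate r s i j" is
   translation by (i, j), reduced mod (r, s). *)

definition vertices :: "int \<Rightarrow> int \<Rightarrow> vertex set" where
  "vertices r s = {0..<r} \<times> {0..<s}"

definition translate :: "int \<Rightarrow> int \<Rightarrow> int \<Rightarrow> int \<Rightarrow> vertex \<Rightarrow> vertex" where
  "translate r s i j v = ((fst v + i) mod r, (snd v + j) mod s)"

definition edges :: "int \<Rightarrow> int \<Rightarrow> vertex set set" where
  "edges r s = (\<Union>v\<in>vertices r s.
     {{v, translate r s 1 0 v}, {v, translate r s 0 1 v}, {v, translate r s 1 1 v}})"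

(* Each triangle of T(r,s) is recorded once, as a vertex triple listed counterclockwise in the
   plane. This fixes the orientation of the torus: any two triangles sharing an edge
   traverse that edge in opposite directions. *)

definition triangles :: "int \<Rightarrow> int \<Rightarrow> (vertex \<times> vertex \<times> vertex) set" where
  "triangles r s =
     (\<lambda>v. (v, translate r s 1 0 v, translate r s 1 1 v)) ` vertices r s \<union>
     (\<lambda>v. (v, translate r s 1 1 v, translate r s 0 1 v)) ` vertices r s"

(* Colorings are extensional (undefined outside V), so that distinct elements differ on V. *)

definition proper_colorings :: "nat \<Rightarrow> 'a set \<Rightarrow> 'a set set \<Rightarrow> ('a \<Rightarrow> nat) set" where
  "proper_colorings q V E =
     {f \<in> V \<rightarrow>\<^sub>E {1..q}. \<forall>u v. {u, v} \<in> E \<longrightarrow> f u \<noteq> f v}"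

abbreviation four_colorings :: "int \<Rightarrow> int \<Rightarrow> (vertex \<Rightarrow> nat) set" where
  "four_colorings r s \<equiv> proper_colorings 4 (vertices r s) (edges r s)"

(* The facets of the tetrahedron, each listed in an order that is positive for the boundary
   orientation: [2,3,4] - [1,3,4] + [1,2,4] - [1,2,3]. *)

definition facets :: "(nat \<times> nat \<times> nat) set" where
  "facets = {(2,3,4), (1,4,3), (1,2,4), (1,3,2)}"

fun rotations :: "'a \<times> 'a \<times> 'a \<Rightarrow> ('a \<times> 'a \<times> 'a) set" where
  "rotations (a, b, c) = {(a, b, c), (b, c, a), (c, a, b)}"

fun opposite :: "'a \<times> 'a \<times> 'a \<Rightarrow> 'a \<times> 'a \<times> 'a" where
  "opposite (a, b, c) = (a, c, b)"

fun image_triple :: "('a \<Rightarrow> 'b) \<Rightarrow> 'a \<times> 'a \<times> 'a \<Rightarrow> 'b \<times> 'b \<times> 'b" where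
  "image_triple f (u, v, w) = (f u, f v, f w)"

definition num_preserved :: "int \<Rightarrow> int \<Rightarrow> (vertex \<Rightarrow> nat) \<Rightarrow> nat \<times> nat \<times> nat \<Rightarrow> nat" where
  "num_preserved r s f \<tau> = card {t \<in> triangles r s. image_triple f t \<in> rotations \<tau>}"

definition num_reversed :: "int \<Rightarrow> int \<Rightarrow> (vertex \<Rightarrow> nat) \<Rightarrow> nat \<times> nat \<times> nat \<Rightarrow> nat" where
  "num_reversed r s f \<tau> = card {t \<in> triangles r s. image_triple f t \<in> rotations (opposite \<tau>)}"

(* Well defined for every four-coloring: see coloring_degree_eq below. *)

definition coloring_degree :: "int \<Rightarrow> int \<Rightarrow> (vertex \<Rightarrow> nat) \<Rightarrow> int" where
  "coloring_degree r s f =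
     (THE d. \<forall>\<tau>\<in>facets. int (num_preserved r s f \<tau>) - int (num_reversed r s f \<tau>) = d)"

definition connected_components :: "'a set set \<Rightarrow> 'a set \<Rightarrow> 'a set set" where
  "connected_components E W = W // {(u, v). u \<in> W \<and> v \<in> W \<and> {u, v} \<in> E}\<^sup>*"

definition bicolored :: "'a set \<Rightarrow> ('a \<Rightarrow> nat) \<Rightarrow> nat \<Rightarrow> nat \<Rightarrow> 'a set" where
  "bicolored V f a b = {v \<in> V. f v = a \<or> f v = b}"

definition swap_colors :: "nat \<Rightarrow> nat \<Rightarrow> 'a set \<Rightarrow> ('a \<Rightarrow> nat) \<Rightarrow> 'a \<Rightarrow> nat" where
  "swap_colors a b W f = (\<lambda>v. if v \<in> W then Transposition.transpose a b (f v) else f v)"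

(* One step of the chain from the state f; "flip" holds the independent fair coins, one for each
   component. *)

definition wsk_step :: "nat \<Rightarrow> 'a set \<Rightarrow> 'a set set \<Rightarrow> ('a \<Rightarrow> nat) \<Rightarrow> ('a \<Rightarrow> nat) pmf" where
  "wsk_step q V E f = do {
     (a, b) \<leftarrow> pmf_of_set {(a, b). a \<in> {1..q} \<and> b \<in> {1..q} \<and> a \<noteq> b};
     let \<C> = connected_components E (bicolored V f a b);
     flip \<leftarrow> Pi_pmf \<C> False (\<lambda>_. bernoulli_pmf (1/2));
     return_pmf (swap_colors a b (\<Union>{C \<in> \<C>. flip C}) f)
   }"

definition steps :: "('a \<Rightarrow> 'a pmf) \<Rightarrow> nat \<Rightarrow> 'a \<Rightarrow> 'a pmf" where
  "steps K n x = ((\<lambda>p. bind_pmf p K) ^^ n) (return_pmf x)"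

definition irreducible_chain :: "'a set \<Rightarrow> ('a \<Rightarrow> 'a pmf) \<Rightarrow> bool" where
  "irreducible_chain S K \<longleftrightarrow> (\<forall>x\<in>S. \<forall>y\<in>S. \<exists>n. pmf (steps K n x) y > 0)"

definition wsk_ergodic :: "nat \<Rightarrow> 'a set \<Rightarrow> 'a set set \<Rightarrow> bool" where
  "wsk_ergodic q V E \<longleftrightarrow> irreducible_chain (proper_colorings q V E) (wsk_step q V E)"

lemma translate_translate: "translate r s i j (translate r s k l v) = translate r s (k + i) (l + j) v"
  by (simp add: translate_def mod_simps algebra_simps)

lemma translate_zero: "v \<in> vertices r s \<Longrightarrow> translate r s 0 0 v = v"
  by (auto simp: translate_def vertices_def)

lemma translate_in_vertices: "r > 0 \<Longrightarrow> s > 0 \<Longrightarrow> translate r s i j v \<in> vertices r s"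
  by (auto simp: translate_def vertices_def)

lemma bij_betw_translate:
  assumes "r > 0" "s > 0"
  shows "bij_betw (translate r s i j) (vertices r s) (vertices r s)"
  by (rule bij_betw_byWitness[where f' = "translate r s (- i) (- j)"])
    (use assms in \<open>auto simp: translate_translate translate_zero translate_in_vertices\<close>)

lemma finite_vertices [simp]: "finite (vertices r s)"
  by (simp add: vertices_def)

lemma sum_triangles:
  fixes g :: "_ \<Rightarrow> int"
  assumes "r \<ge> 2" "s \<ge> 2"
  shows "(\<Sum>t\<in>triangles r s. g t) =
    (\<Sum>v\<in>vertices r s. g (v, translate r s 1 0 v, translate r s 1 1 v)) +
    (\<Sum>v\<in>vertices r s. g (v, translate r s 1 1 v, translate r s 0 1 v))"
proof -
  have ne: "(y + 1) mod s \<noteq> y" if "y \<in> {0..<s}" for y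
  proof
    assume "(y + 1) mod s = y"
    then have "[y + 1 = y + 0] (mod s)" using that by (simp add: cong_def)
    then have "[1 = 0] (mod s)" by (simp only: cong_add_lcancel)
    then show False using assms by (simp add: cong_def)
  qed
  let ?A = "\<lambda>v. (v, translate r s 1 0 v, translate r s 1 1 v)"
  let ?B = "\<lambda>v. (v, translate r s 1 1 v, translate r s 0 1 v)"
  have "?A ` vertices r s \<inter> ?B ` vertices r s = {}"
    using ne by (auto simp: vertices_def translate_def eq_commute[of _ "(_ + 1) mod s"])
  moreover have "inj_on ?A (vertices r s)" "inj_on ?B (vertices r s)"
    by (auto simp: inj_on_def)
  ultimately show ?thesis
    by (simp add: triangles_def sum.union_disjoint sum.reindex)
qed

lemma sum_of_bool:
  "finite A \<Longrightarrow> (\<Sum>t\<in>A. of_bool (P t)) = int (card {t \<in> A. P t})"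
  by (simp add: of_bool_def sum.If_cases Collect_conj_eq)

lemma coloring_degree_eq:
  assumes "r \<ge> 2" "s \<ge> 2" and f: "f \<in> four_colorings r s" and "\<tau> \<in> facets"
  shows "coloring_degree r s f = int (num_preserved r s f \<tau>) - int (num_reversed r s f \<tau>)"
proof -
  define D where "D \<tau> = int (num_preserved r s f \<tau>) - int (num_reversed r s f \<tau>)" for \<tau>
  define h :: "nat \<Rightarrow> nat \<Rightarrow> nat \<Rightarrow> nat \<Rightarrow> int"
    where "h a b i j = of_bool (i = a \<and> j = b) - of_bool (i = b \<and> j = a)" for a b i j
  define \<epsilon> :: "nat \<times> nat \<times> nat \<Rightarrow> nat \<times> nat \<times> nat \<Rightarrow> int"
    where "\<epsilon> \<tau> c = of_bool (c \<in> rotations \<tau>) - of_bool (c \<in> rotations (opposite \<tau>))" for \<tau> c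
  have pos: "r > 0" "s > 0" using assms by auto
  have fin: "finite (triangles r s)" by (simp add: triangles_def)
  have D: "D \<tau> = (\<Sum>t\<in>triangles r s. \<epsilon> \<tau> (image_triple f t))" for \<tau>
    by (simp only: D_def num_preserved_def num_reversed_def \<epsilon>_def sum_subtractf sum_of_bool[OF fin])
  define H where "H a b t = h a b (f (fst t)) (f (fst (snd t))) +
    h a b (f (fst (snd t))) (f (snd (snd t))) + h a b (f (snd (snd t))) (f (fst t))" for a b t
  have anti: "h a b i j = - h a b j i" for a b i j
    by (simp only: h_def minus_diff_eq conj_commute)
  have cancel: "(\<Sum>t\<in>triangles r s. H a b t) = 0" for a b
  proof -
    define g1 where "g1 v = h a b (f v) (f (translate r s 1 0 v))" for v
    define g2 where "g2 v = h a b (f v) (f (translate r s 0 1 v))" for v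
    have "(\<Sum>t\<in>triangles r s. H a b t) =
      (\<Sum>v\<in>vertices r s. H a b (v, translate r s 1 0 v, translate r s 1 1 v) +
         H a b (v, translate r s 1 1 v, translate r s 0 1 v))"
      using sum_triangles[OF assms(1,2)] by (simp add: sum.distrib)
    also have "\<dots> = (\<Sum>v\<in>vertices r s. (g1 v - g1 (translate r s 0 1 v)) + (g2 (translate r s 1 0 v) - g2 v))"
    proof (rule sum.cong)
      fix v
      show "H a b (v, translate r s 1 0 v, translate r s 1 1 v) +
         H a b (v, translate r s 1 1 v, translate r s 0 1 v) =
         (g1 v - g1 (translate r s 0 1 v)) + (g2 (translate r s 1 0 v) - g2 v)"
        using anti[of a b "f v" "f (translate r s 1 1 v)"]
          anti[of a b "f (translate r s 1 1 v)" "f (translate r s 0 1 v)"]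
          anti[of a b "f v" "f (translate r s 0 1 v)"]
        unfolding H_def g1_def g2_def translate_translate by simp
    qed simp
    also have "\<dots> = 0"
      using sum.reindex_bij_betw[OF bij_betw_translate[OF pos], of g1 0 1]
        sum.reindex_bij_betw[OF bij_betw_translate[OF pos], of g2 1 0]
      by (simp add: sum.distrib sum_subtractf)
    finally show ?thesis .
  qed
  have cols: "\<exists>i j k. image_triple f t = (i, j, k) \<and> i \<in> {1,2,3,4} \<and> j \<in> {1,2,3,4} \<and> k \<in> {1,2,3,4}
      \<and> i \<noteq> j \<and> j \<noteq> k \<and> k \<noteq> i \<and>
      (\<forall>a b. H a b t = h a b i j + h a b j k + h a b k i)" if t: "t \<in> triangles r s" for t
  proof -
    obtain u v w where t': "t = (u, v, w)" by (cases t)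
    have "u \<in> vertices r s" "v \<in> vertices r s" "w \<in> vertices r s"
      using t by (auto simp: t' triangles_def translate_in_vertices pos)
    then have "f u \<in> {1..4}" "f v \<in> {1..4}" "f w \<in> {1..4}"
      using f unfolding proper_colorings_def by blast+
    moreover have "{1..4::nat} = {1,2,3,4}" by auto
    ultimately have "f u \<in> {1,2,3,4}" "f v \<in> {1,2,3,4}" "f w \<in> {1,2,3,4}" by blast+
    moreover have "\<exists>x\<in>vertices r s. (u, v, w) = (x, translate r s 1 0 x, translate r s 1 1 x) \<or>
        (u, v, w) = (x, translate r s 1 1 x, translate r s 0 1 x)"
      using t by (auto simp: t' triangles_def)
    then obtain x where x: "x \<in> vertices r s" and "(u, v, w) = (x, translate r s 1 0 x, translate r s 1 1 x) \<or>
        (u, v, w) = (x, translate r s 1 1 x, translate r s 0 1 x)" by blast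
    then have "{u, v} \<in> edges r s \<and> {v, w} \<in> edges r s \<and> {w, u} \<in> edges r s"
    proof (elim disjE)
      assume "(u, v, w) = (x, translate r s 1 0 x, translate r s 1 1 x)"
      moreover have "{v, translate r s 0 1 v} \<in> edges r s" if "v \<in> vertices r s" for v
        using that unfolding edges_def by blast
      from this[of "translate r s 1 0 x"] have "{translate r s 1 0 x, translate r s 1 1 x} \<in> edges r s"
        by (simp add: translate_in_vertices pos translate_translate)
      moreover have "{x, translate r s 1 0 x} \<in> edges r s" "{x, translate r s 1 1 x} \<in> edges r s"
        using x unfolding edges_def by blast+
      ultimately show ?thesis by (simp add: insert_commute)
    next
      assume "(u, v, w) = (x, translate r s 1 1 x, translate r s 0 1 x)"
      moreover have "{v, translate r s 1 0 v} \<in> edges r s" if "v \<in> vertices r s" for v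
        using that unfolding edges_def by blast
      from this[of "translate r s 0 1 x"] have "{translate r s 0 1 x, translate r s 1 1 x} \<in> edges r s"
        by (simp add: translate_in_vertices pos translate_translate)
      moreover have "{x, translate r s 0 1 x} \<in> edges r s" "{x, translate r s 1 1 x} \<in> edges r s"
        using x unfolding edges_def by blast+
      ultimately show ?thesis by (simp add: insert_commute)
    qed
    then have "f u \<noteq> f v" "f v \<noteq> f w" "f w \<noteq> f u"
      using f unfolding proper_colorings_def by blast+
    moreover have "image_triple f t = (f u, f v, f w)" by (simp add: t')
    moreover have "\<forall>a b. H a b t = h a b (f u) (f v) + h a b (f v) (f w) + h a b (f w) (f u)"
      unfolding H_def t' by simp
    ultimately show ?thesis by (intro exI[of _ "f u"] exI[of _ "f v"] exI[of _ "f w"] conjI)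
  qed
  have pair: "D \<tau> = D \<tau>'" if "\<And>i j k. i \<in> {1,2,3,4} \<Longrightarrow> j \<in> {1,2,3,4} \<Longrightarrow> k \<in> {1,2,3,4} \<Longrightarrow>
      i \<noteq> j \<Longrightarrow> j \<noteq> k \<Longrightarrow> k \<noteq> i \<Longrightarrow>
      \<epsilon> \<tau> (i, j, k) - \<epsilon> \<tau>' (i, j, k) = h a b i j + h a b j k + h a b k i" for \<tau> \<tau>' a b
  proof -
    have "D \<tau> - D \<tau>' = (\<Sum>t\<in>triangles r s. H a b t)"
      unfolding D sum_subtractf[symmetric]
    proof (rule sum.cong)
      fix t assume "t \<in> triangles r s"
      from cols[OF this] obtain i j k where
        ijk: "image_triple f t = (i, j, k)" "i \<in> {1,2,3,4}" "j \<in> {1,2,3,4}" "k \<in> {1,2,3,4}"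
          "i \<noteq> j" "j \<noteq> k" "k \<noteq> i"
        and H: "\<forall>a b. H a b t = h a b i j + h a b j k + h a b k i"
        by (elim exE conjE)
      show "\<epsilon> \<tau> (image_triple f t) - \<epsilon> \<tau>' (image_triple f t) = H a b t"
        unfolding ijk(1) H[rule_format] by (rule that) (rule ijk(2-))+
    qed simp
    then show ?thesis using cancel by simp
  qed
  have "D (2,3,4) = D (1,4,3)"
    by (rule pair[where a = 3 and b = 4], elim insertE emptyE)
      (simp_all add: \<epsilon>_def h_def)
  moreover have "D (2,3,4) = D (1,2,4)"
    by (rule pair[where a = 4 and b = 2], elim insertE emptyE)
      (simp_all add: \<epsilon>_def h_def)
  moreover have "D (2,3,4) = D (1,3,2)"
    by (rule pair[where a = 2 and b = 3], elim insertE emptyE)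
      (simp_all add: \<epsilon>_def h_def)
  ultimately have "\<forall>\<sigma>\<in>facets. D \<sigma> = D \<tau>"
    using \<open>\<tau> \<in> facets\<close> by (auto simp: facets_def)
  then have "(THE d. \<forall>\<sigma>\<in>facets. D \<sigma> = d) = D \<tau>"
    using \<open>\<tau> \<in> facets\<close> by (intro the_equality) (blast, metis)
  then show ?thesis
    unfolding coloring_degree_def D_def .
qed

end

theory Submission
  imports Defs
begin

text \<open>
  The degree modulo 12 is invariant under Kempe changes. Modulo 3 every four-coloring has degree 0:
  label each edge by the perfect matching of the four colors (an element of \<open>Z/3\<close>) that contains
  its two colors. The labels around a triangle form an arithmetic progression whose difference
  is the sign of the triangle, and summing labels weighted by the proper three-coloring
  \<open>(x, y) \<mapsto> x + y\<close> exhibits the sign as a coboundary. Modulo 4, exchanging colors \<open>a\<close> and \<open>b\<close> on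
  Kempe chains reverses the triangles \<open>abc\<close> on these chains, and their number is even because
  the link of a vertex is a 6-cycle colored by the three other colors, which has an even number
  of edges \<open>bc\<close>. The three-coloring has degree 0, so it cannot be connected to a coloring of
  degree 6. Such a coloring is given by a finite table for \<open>L = M = 3\<close>, together with
  three columns and three rows that can be repeated without changing the degree.
\<close>

section \<open>The degree as a sum of local signs\<close>

definition facet_sign :: "nat \<times> nat \<times> nat \<Rightarrow> nat \<times> nat \<times> nat \<Rightarrow> int" where
  "facet_sign \<tau> c = of_bool (c \<in> rotations \<tau>) - of_bool (c \<in> rotations (opposite \<tau>))"

text \<open>The freedom in the facet matters: modulo 3 all four facets are summed, modulo 4 one
  containing both exchanged colors is chosen, and explicit colorings are evaluated on
  \<open>(2, 3, 4)\<close>.\<close>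

lemma coloring_degree_sum:
  assumes "r \<ge> 2" "s \<ge> 2" "f \<in> four_colorings r s" "\<tau> \<in> facets"
  shows "coloring_degree r s f = (\<Sum>v\<in>vertices r s.
    facet_sign \<tau> (f v, f (translate r s 1 0 v), f (translate r s 1 1 v)) +
    facet_sign \<tau> (f v, f (translate r s 1 1 v), f (translate r s 0 1 v)))"
proof -
  have fin: "finite (triangles r s)" by (simp add: triangles_def)
  have "coloring_degree r s f = (\<Sum>t\<in>triangles r s. facet_sign \<tau> (image_triple f t))"
    unfolding coloring_degree_eq[OF assms] num_preserved_def num_reversed_def facet_sign_def
    by (simp only: sum_subtractf sum_of_bool[OF fin])
  then show ?thesis
    by (simp only: sum_triangles[OF assms(1,2)] sum.distrib image_triple.simps)
qed

lemma sum_translate: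
  fixes g :: "vertex \<Rightarrow> int"
  assumes "r > 0" "s > 0"
  shows "(\<Sum>v\<in>vertices r s. g (translate r s i j v)) = (\<Sum>v\<in>vertices r s. g v)"
  using sum.reindex_bij_betw[OF bij_betw_translate[OF assms]] .

lemma translate_edges:
  assumes "r > 0" "s > 0" "v \<in> vertices r s"
  shows "{v, translate r s 1 0 v} \<in> edges r s"
    and "{v, translate r s 0 1 v} \<in> edges r s"
    and "{v, translate r s 1 1 v} \<in> edges r s"
    and "{translate r s 1 0 v, translate r s 1 1 v} \<in> edges r s"
    and "{translate r s 0 1 v, translate r s 1 1 v} \<in> edges r s"
proof -
  have *: "{v, translate r s 1 0 v} \<in> edges r s \<and> {v, translate r s 0 1 v} \<in> edges r s \<and>
      {v, translate r s 1 1 v} \<in> edges r s" if "v \<in> vertices r s" for v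
    using that unfolding edges_def by blast
  show "{v, translate r s 1 0 v} \<in> edges r s" "{v, translate r s 0 1 v} \<in> edges r s"
    "{v, translate r s 1 1 v} \<in> edges r s"
    using *[OF assms(3)] by auto
  show "{translate r s 1 0 v, translate r s 1 1 v} \<in> edges r s"
    using *[of "translate r s 1 0 v"] assms by (simp add: translate_in_vertices translate_translate)
  show "{translate r s 0 1 v, translate r s 1 1 v} \<in> edges r s"
    using *[of "translate r s 0 1 v"] assms by (simp add: translate_in_vertices translate_translate)
qed

lemma four_coloring_range:
  assumes "f \<in> four_colorings r s" "v \<in> vertices r s"
  shows "f v \<in> {1, 2, 3, 4}"
proof -
  have "f v \<in> {1..4}" using assms by (auto simp: proper_colorings_def)
  then show ?thesis by auto
qed

lemma proper_coloring_neq: "f \<in> proper_colorings q V E \<Longrightarrow> {u, v} \<in> E \<Longrightarrow> f u \<noteq> f v"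
  by (auto simp: proper_colorings_def)

section \<open>Divisibility of the degree by three\<close>

text \<open>Numbers the three perfect matchings 12|34, 13|24, 14|23 of the four colors by 0, 1, 2.\<close>

definition matching :: "nat \<Rightarrow> nat \<Rightarrow> int" where
  "matching i j = (if i + j = 5 then 2 else if even (i + j) then 1 else 0)"

lemma matching_commute: "matching i j = matching j i"
  by (simp add: matching_def add.commute)

lemma sum_facets:
  fixes g :: "_ \<Rightarrow> int"
  shows "(\<Sum>\<tau>\<in>facets. g \<tau>) = g (2, 3, 4) + g (1, 4, 3) + g (1, 2, 4) + g (1, 3, 2)"
  by (simp add: facets_def)

text \<open>The sides of a color triangle lie in three different matchings, so the labels are 0, 1,
  2 in some order. Reversing the triangle reverses their cyclic order, hence the step from one label
  to the next is the sign. Only the facet with these three colors contributes to the sum.\<close>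

lemma matching_triangle:
  assumes "i \<in> {1, 2, 3, 4}" "j \<in> {1, 2, 3, 4}" "k \<in> {1, 2, 3, 4}" "i \<noteq> j" "j \<noteq> k" "i \<noteq> k"
  shows "[matching i j + matching j k + matching i k = 0] (mod 3)"
    and "[(\<Sum>\<tau>\<in>facets. facet_sign \<tau> (i, j, k)) = matching j k - matching i j] (mod 3)"
  using assms unfolding sum_facets
  by (elim insertE emptyE; hypsubst_thin; simp add: matching_def facet_sign_def cong_def)+

text \<open>Reduction at the seams does not disturb \<open>x + y\<close> modulo a common divisor of
  the side lengths. With 3 as divisor this serves both the coboundary weight and the
  three-coloring.\<close>

lemma translate_cong:
  assumes "k dvd r" "k dvd s"
  shows "[fst (translate r s i j v) + snd (translate r s i j v) = fst v + snd v + (i + j)] (mod k)"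
proof -
  have "[(fst v + i) mod r = fst v + i] (mod k)" "[(snd v + j) mod s = snd v + j] (mod k)"
    using assms by (simp_all add: cong_def mod_mod_cancel)
  from cong_add[OF this] show ?thesis by (simp add: translate_def algebra_simps)
qed

lemma degree_cong_0_mod_3:
  assumes "3 dvd r" "3 dvd s" "r > 0" "s > 0" and f: "f \<in> four_colorings r s"
  shows "[coloring_degree r s f = 0] (mod 3)"
proof -
  have rs: "r \<ge> 2" "s \<ge> 2" using assms by (auto simp: dvd_def)
  let ?V = "vertices r s"
  define c where "c v = fst v + snd v" for v :: vertex
  \<comment> \<open>The coboundary: horizontal and vertical labels weighted by \<open>c\<close> at
    the initial vertex. Diagonal labels are eliminated by the relations \<open>1\<close> and
    \<open>2\<close> below.\<close>
  define H where "H v = c v * matching (f v) (f (translate r s 1 0 v))" for v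
  define U where "U v = c v * matching (f v) (f (translate r s 0 1 v))" for v
  have c: "[c (translate r s i j v) = c v + (i + j)] (mod 3)" for i j v
    unfolding c_def by (rule translate_cong[OF assms(1,2)])
  have step: "[(\<Sum>\<tau>\<in>facets. facet_sign \<tau> (f v, f (translate r s 1 0 v), f (translate r s 1 1 v)) +
        facet_sign \<tau> (f v, f (translate r s 1 1 v), f (translate r s 0 1 v))) =
      (U v - U (translate r s 1 0 v)) + (H (translate r s 0 1 v) - H v)] (mod 3)"
    if v: "v \<in> ?V" for v
  proof -
    let ?v1 = "translate r s 1 0 v" and ?v2 = "translate r s 0 1 v" and ?w = "translate r s 1 1 v"
    define p where "p = matching (f v) (f ?v1)"
    define q where "q = matching (f ?v1) (f ?w)"
    define d where "d = matching (f v) (f ?w)"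
    define p' where "p' = matching (f ?v2) (f ?w)"
    define q' where "q' = matching (f v) (f ?v2)"
    note E = translate_edges[OF assms(3,4) v]
    have ne: "f v \<noteq> f ?v1" "f ?v1 \<noteq> f ?w" "f v \<noteq> f ?w" "f v \<noteq> f ?v2" "f ?v2 \<noteq> f ?w" "f ?w \<noteq> f ?v2"
      using E proper_coloring_neq[OF f] by metis+
    have range: "f v \<in> {1,2,3,4}" "f ?v1 \<in> {1,2,3,4}" "f ?v2 \<in> {1,2,3,4}" "f ?w \<in> {1,2,3,4}"
      using four_coloring_range[OF f] v assms(3,4) by (simp_all only: translate_in_vertices)
    have 1: "[p + q + d = 0] (mod 3)"
      using matching_triangle(1)[OF range(1,2,4) ne(1,2,3)] by (simp add: p_def q_def d_def)
    have 2: "[p' + q' + d = 0] (mod 3)"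
      using matching_triangle(1)[OF range(1,3,4) ne(4,5,3)]
      by (simp add: p'_def q'_def d_def ac_simps)
    have "[(\<Sum>\<tau>\<in>facets. facet_sign \<tau> (f v, f ?v1, f ?w) + facet_sign \<tau> (f v, f ?w, f ?v2)) =
        (q - p) + (p' - d)] (mod 3)"
      unfolding sum.distrib p_def q_def d_def p'_def matching_commute[of "f ?v2"]
      by (intro cong_add matching_triangle(2) range ne)
    \<comment> \<open>The first two brackets become the differences of \<open>U\<close> and of
      \<open>H\<close>, since \<open>c\<close> grows by 1 along either edge. The last bracket
      vanishes modulo 3 by \<open>1\<close> and \<open>2\<close>.\<close>
    also have "(q - p) + (p' - d) = (c v * q' - (c v + 1) * q) + ((c v + 1) * p' - c v * p) +
        ((c v + 2) * (p + q + d) - c v * (p' + q' + d) - 3 * (p + d))"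
      by (simp add: algebra_simps)
    also have "[\<dots> = (c v * q' - (c v + 1) * q) + ((c v + 1) * p' - c v * p) +
        ((c v + 2) * 0 - c v * 0 - 0)] (mod 3)"
      by (intro cong_add cong_diff cong_scalar_left 1 2 cong_refl) (simp add: cong_def)
    also have "(c v * q' - (c v + 1) * q) + ((c v + 1) * p' - c v * p) + ((c v + 2) * 0 - c v * 0 - 0) =
        (c v * q' - (c v + 1) * q) + ((c v + 1) * p' - c v * p)" by simp
    also have "[\<dots> = (U v - U ?v1) + (H ?v2 - H v)] (mod 3)"
    proof -
      have "U ?v1 = c ?v1 * q" "H ?v2 = c ?v2 * p'" "U v = c v * q'" "H v = c v * p"
        by (simp_all add: U_def H_def p_def q_def p'_def q'_def translate_translate)
      moreover have "[c v + 1 = c ?v1] (mod 3)" "[c v + 1 = c ?v2] (mod 3)"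
        using c[of 1 0 v] c[of 0 1 v] by (simp_all add: cong_sym)
      ultimately show ?thesis
        by (simp only:) (intro cong_add cong_diff cong_scalar_right cong_refl)
    qed
    finally show ?thesis .
  qed
  \<comment> \<open>The labels see the sign of a triangle but not its facet, so all facets are
    summed; the resulting factor 4 is invertible modulo 3.\<close>
  have "4 * coloring_degree r s f = (\<Sum>\<tau>\<in>facets. coloring_degree r s f)"
    by (simp add: facets_def)
  also have "\<dots> = (\<Sum>\<tau>\<in>facets. \<Sum>v\<in>?V.
      facet_sign \<tau> (f v, f (translate r s 1 0 v), f (translate r s 1 1 v)) +
      facet_sign \<tau> (f v, f (translate r s 1 1 v), f (translate r s 0 1 v)))"
    by (intro sum.cong refl coloring_degree_sum rs f)
  also have "\<dots> = (\<Sum>v\<in>?V. \<Sum>\<tau>\<in>facets.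
      facet_sign \<tau> (f v, f (translate r s 1 0 v), f (translate r s 1 1 v)) +
      facet_sign \<tau> (f v, f (translate r s 1 1 v), f (translate r s 0 1 v)))"
    by (rule sum.swap)
  finally have "[4 * coloring_degree r s f =
      (\<Sum>v\<in>?V. (U v - U (translate r s 1 0 v)) + (H (translate r s 0 1 v) - H v))] (mod 3)"
    by (simp only:) (rule cong_sum, rule step)
  moreover have "(\<Sum>v\<in>?V. (U v - U (translate r s 1 0 v)) + (H (translate r s 0 1 v) - H v)) = 0"
    unfolding sum.distrib sum_subtractf
      sum_translate[OF assms(3,4), of U] sum_translate[OF assms(3,4), of H] by simp
  ultimately have "3 dvd 4 * coloring_degree r s f" by (simp only: cong_0_iff)
  then have "3 dvd coloring_degree r s f" by presburger
  then show ?thesis by (simp add: cong_0_iff)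
qed

section \<open>Kempe changes preserve the degree modulo four\<close>

text \<open>The transposition is an involution, so it can be moved from the triple to the facet.
  There it is an odd permutation of the three vertices and swaps the two cyclic orders.\<close>

lemma facet_sign_flip:
  assumes "distinct [p, q, r]" "a \<in> {p, q, r}" "b \<in> {p, q, r}" "a \<noteq> b"
  shows "facet_sign (p, q, r) (Transposition.transpose a b i, Transposition.transpose a b j,
    Transposition.transpose a b k) = - facet_sign (p, q, r) (i, j, k)"
proof -
  let ?T = "Transposition.transpose a b"
  have T: "?T x = y \<longleftrightarrow> x = ?T y" for x y
    by (metis transpose_involutory)
  have rot: "(?T i, ?T j, ?T k) \<in> rotations (x, y, z) \<longleftrightarrow> (i, j, k) \<in> rotations (?T x, ?T y, ?T z)" for x y z
    by (simp add: T)
  have "rotations (?T p, ?T q, ?T r) = rotations (p, r, q) \<and>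
      rotations (?T p, ?T r, ?T q) = rotations (p, q, r)"
    using assms by (elim insertE emptyE; simp add: insert_commute)
  then show ?thesis
    by (simp only: facet_sign_def rot opposite.simps minus_diff_eq)
qed

lemma facet_sign_unit:
  assumes "distinct [p, q, r]" "{i, j, k} = {p, q, r}"
  shows "facet_sign (p, q, r) (i, j, k) \<in> {1, -1}"
proof -
  have "i \<in> {p, q, r}" "j \<in> {p, q, r}" "k \<in> {p, q, r}" using assms(2) by blast+
  moreover have "card {i, j, k} = 3" using assms by simp
  then have "i \<noteq> j" "j \<noteq> k" "i \<noteq> k" by (auto simp: card_insert_if split: if_splits)
  moreover have "p \<noteq> q" "q \<noteq> r" "p \<noteq> r" using assms(1) by auto
  ultimately have "(i, j, k) \<in> rotations (p, q, r) \<longleftrightarrow> (i, j, k) \<notin> rotations (p, r, q)"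
    unfolding rotations.simps insert_iff prod.inject empty_iff by metis
  then show ?thesis
    unfolding facet_sign_def opposite.simps
    by (cases "(i, j, k) \<in> rotations (p, q, r)")
      (simp_all del: rotations.simps)
qed

lemma facet_sign_zero:
  assumes "x \<in> {i, j, k}" "x \<notin> {p, q, r}"
  shows "facet_sign (p, q, r) (i, j, k) = 0"
proof -
  have "(i, j, k) \<notin> rotations (p, q, r)" "(i, j, k) \<notin> rotations (p, r, q)"
    using assms by auto
  then show ?thesis by (simp only: facet_sign_def opposite.simps of_bool_eq)
qed

text \<open>For a triangle inside the facet, the bracket counts its vertices of color \<open>a\<close> that are flipped.
  The terms with \<open>d\<close> cancel the count for every other triangle.\<close>

lemma facet_sign_kempe:
  assumes dist: "distinct [p, q, r, d]" and sub: "{i, j, k} \<subseteq> {p, q, r, d}" and ijk: "distinct [i, j, k]"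
    and ab: "a \<in> {p, q, r}" "b \<in> {p, q, r}" "a \<noteq> b"
    and P: "P \<Longrightarrow> i \<in> {a, b}" "Q \<Longrightarrow> j \<in> {a, b}" "R \<Longrightarrow> k \<in> {a, b}"
    and PQ: "{i, j} = {a, b} \<Longrightarrow> P = Q" "{j, k} = {a, b} \<Longrightarrow> Q = R" "{i, k} = {a, b} \<Longrightarrow> P = R"
  shows "[facet_sign (p, q, r) (i, j, k) -
      facet_sign (p, q, r) (if P then Transposition.transpose a b i else i,
        if Q then Transposition.transpose a b j else j, if R then Transposition.transpose a b k else k) =
      2 * (of_bool (P \<and> i = a) * (1 - of_bool (j = d) - of_bool (k = d)) +
        of_bool (Q \<and> j = a) * (1 - of_bool (k = d) - of_bool (i = d)) +
        of_bool (R \<and> k = a) * (1 - of_bool (i = d) - of_bool (j = d)))] (mod 4)"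
proof (cases "d \<in> {i, j, k}")
  case True
  let ?T = "Transposition.transpose a b"
  have d: "d \<notin> {p, q, r}" using dist by auto
  then have dab: "d \<noteq> a" "d \<noteq> b" using ab(1,2) by blast+
  then have "?T d = d" by simp
  have d': "d \<in> {if P then ?T i else i, if Q then ?T j else j, if R then ?T k else k}"
    using True \<open>?T d = d\<close> by auto
  \<comment> \<open>A flipped corner of color \<open>a\<close> has exactly one other corner of color
    \<open>d\<close>, so its bracket is 1 - 1 = 0, while both signs vanish.\<close>
  show ?thesis
    unfolding facet_sign_zero[OF True d] facet_sign_zero[OF d' d]
    using True ijk dab by (elim insertE emptyE) simp_all
next
  case False
  let ?T = "Transposition.transpose a b"
  let ?S = "facet_sign (p, q, r)"
  have "card {i, j, k} = 3" "card {p, q, r} = 3" using ijk dist by auto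
  moreover have "{i, j, k} \<subseteq> {p, q, r}" using sub False by auto
  ultimately have eq: "{i, j, k} = {p, q, r}" by (simp add: card_subset_eq)
  have S: "?S (i, j, k) \<in> {1, -1}" using facet_sign_unit[OF _ eq] dist by simp
  have flip: "?S (?T i, ?T j, ?T k) = - ?S (i, j, k)"
    using facet_sign_flip[OF _ ab] dist by simp
  \<comment> \<open>Both \<open>a\<close> and \<open>b\<close> occur, on adjacent corners, which
    flip together. A flip thus transposes the whole triangle and changes the sign by 2 or -2, both
    congruent to 2 modulo 4.\<close>
  define X where "X \<longleftrightarrow> (P \<or> Q \<or> R)"
  have "a \<in> {i, j, k}" "b \<in> {i, j, k}" using ab eq by auto
  then have PQR: "P = (X \<and> i \<in> {a, b})" "Q = (X \<and> j \<in> {a, b})" "R = (X \<and> k \<in> {a, b})"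
    and one: "of_bool (i = a) + of_bool (j = a) + of_bool (k = a) = (1 :: int)"
    using P PQ ijk ab(3) unfolding X_def by auto
  \<comment> \<open>The transposition fixes the third color, so it may be applied to that corner
    too.\<close>
  have T: "(if P then ?T x else x) = (if X then ?T x else x)"
    if "P = (X \<and> x \<in> {a, b})" for P x
    using that by (auto simp: Transposition.transpose_def)
  have "of_bool (P \<and> i = a) * (1 - of_bool (j = d) - of_bool (k = d)) +
        of_bool (Q \<and> j = a) * (1 - of_bool (k = d) - of_bool (i = d)) +
        of_bool (R \<and> k = a) * (1 - of_bool (i = d) - of_bool (j = d)) =
     (of_bool X * (of_bool (i = a) + of_bool (j = a) + of_bool (k = a)) :: int)"
    using False PQR by auto
  then show ?thesis
    unfolding one T[OF PQR(1)] T[OF PQR(2)] T[OF PQR(3)]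
    using S flip by (cases X) (auto simp: cong_def)
qed

text \<open>The hypothesis on \<open>W\<close> says that it is a union of Kempe chains.\<close>

lemma swap_colors_proper:
  assumes f: "f \<in> proper_colorings q V E" and ab: "a \<in> {1..q}" "b \<in> {1..q}"
    and W: "W \<subseteq> bicolored V f a b"
    and closed: "\<And>u v. {u, v} \<in> E \<Longrightarrow> u \<in> W \<Longrightarrow> v \<in> bicolored V f a b \<Longrightarrow> v \<in> W"
    and E: "\<And>u v. {u, v} \<in> E \<Longrightarrow> u \<in> V"
  shows "swap_colors a b W f \<in> proper_colorings q V E"
proof -
  let ?g = "swap_colors a b W f"
  have g: "?g v = (if v \<in> W then Transposition.transpose a b (f v) else f v)" for v
    by (simp add: swap_colors_def)
  have fV: "f v \<in> {1..q}" if "v \<in> V" for v using f that by (auto simp: proper_colorings_def)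
  have "?g v \<in> {1..q}" if "v \<in> V" for v
    using fV[OF that] ab by (auto simp: g Transposition.transpose_def)
  moreover have "?g v = undefined" if "v \<notin> V" for v
    using f W that by (auto simp: g proper_colorings_def bicolored_def PiE_def extensional_def)
  moreover have "?g u \<noteq> ?g v" if uv: "{u, v} \<in> E" for u v
  proof -
    have vu: "{v, u} \<in> E" using uv by (simp add: insert_commute)
    have ne: "f u \<noteq> f v" using proper_coloring_neq[OF f uv] .
    have V: "u \<in> V" "v \<in> V" using E[OF uv] E[OF vu] by auto
    have out: "f y \<notin> {a, b}" "f x \<in> {a, b}" if "{x, y} \<in> E" "x \<in> W" "y \<notin> W" "y \<in> V" for x y
      using closed[of x y] that W by (auto simp: bicolored_def)
    have ne': "Transposition.transpose a b (f x) \<noteq> f y" if "{x, y} \<in> E" "x \<in> W" "y \<notin> W" "y \<in> V" for x y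
      using out[OF that] by (auto simp: Transposition.transpose_def)
    show ?thesis
      using ne ne'[OF uv] ne'[OF vu] V unfolding g by (auto dest: injD[OF inj_transpose])
  qed
  ultimately show ?thesis
    unfolding proper_colorings_def by (auto simp: PiE_def extensional_def)
qed

lemma edges_subset:
  assumes "r > 0" "s > 0" "{u, v} \<in> edges r s"
  shows "u \<in> vertices r s"
proof -
  obtain x i j where "x \<in> vertices r s" "{u, v} = {x, translate r s i j x}"
    using assms(3) unfolding edges_def by blast
  then have "u = x \<or> u = translate r s i j x" "x \<in> vertices r s" by (auto simp: doubleton_eq_iff)
  then show ?thesis using translate_in_vertices[OF assms(1,2)] by metis
qed

text \<open>Two colors avoid one of 1, 2, 3; the facet opposite to it contains both, and
  \<open>d\<close> is the avoided color.\<close>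

lemma facet_containing:
  assumes "a \<in> {1..4::nat}" "b \<in> {1..4}" "a \<noteq> b"
  obtains p q t d where "(p, q, t) \<in> facets" "a \<in> {p, q, t}" "b \<in> {p, q, t}"
    "distinct [p, q, t, d]" "{1, 2, 3, 4} = {p, q, t, d}"
proof -
  have "{1..4::nat} = {1, 2, 3, 4}" by auto
  then have ab: "a \<in> {1, 2, 3, 4}" "b \<in> {1, 2, 3, 4}" using assms by auto
  have "a \<noteq> 1 \<and> b \<noteq> 1 \<or> a \<noteq> 2 \<and> b \<noteq> 2 \<or> a \<noteq> 3 \<and> b \<noteq> 3" by presburger
  then show ?thesis
  proof (elim disjE)
    assume "a \<noteq> 1 \<and> b \<noteq> 1" then show ?thesis using ab by (intro that[of 2 3 4 1]) (auto simp: facets_def)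
  next
    assume "a \<noteq> 2 \<and> b \<noteq> 2" then show ?thesis using ab by (intro that[of 1 4 3 2]) (auto simp: facets_def)
  next
    assume "a \<noteq> 3 \<and> b \<noteq> 3" then show ?thesis using ab by (intro that[of 1 2 4 3]) (auto simp: facets_def)
  qed
qed

text \<open>Writing the change of the degree as twice a count of corners, the corners at each vertex
  come in an even number since every vertex has the even degree six.\<close>

lemma kempe_degree_mod_4:
  assumes rs: "r \<ge> 2" "s \<ge> 2" and f: "f \<in> four_colorings r s"
    and g: "swap_colors a b W f \<in> four_colorings r s"
    and ab: "a \<in> {1..4}" "b \<in> {1..4}" "a \<noteq> b"
    and W: "W \<subseteq> bicolored (vertices r s) f a b"
    and closed: "\<And>u v. {u, v} \<in> edges r s \<Longrightarrow> u \<in> W \<Longrightarrow>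
      v \<in> bicolored (vertices r s) f a b \<Longrightarrow> v \<in> W"
  shows "[coloring_degree r s (swap_colors a b W f) = coloring_degree r s f] (mod 4)"
proof -
  let ?V = "vertices r s" and ?g = "swap_colors a b W f"
  let ?t = "translate r s"
  have pos: "r > 0" "s > 0" using rs by auto
  obtain p q t d where \<tau>: "(p, q, t) \<in> facets" and pqt: "a \<in> {p, q, t}" "b \<in> {p, q, t}"
    and dist: "distinct [p, q, t, d]" and all: "{1, 2, 3, 4} = {p, q, t, d}"
    using facet_containing[OF ab] .
  let ?s = "facet_sign (p, q, t)"
  define \<omega> :: "vertex \<Rightarrow> int" where "\<omega> v = of_bool (v \<in> W \<and> f v = a)" for v
  define \<delta> :: "vertex \<Rightarrow> int" where "\<delta> v = of_bool (f v = d)" for v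
  \<comment> \<open>The corner count of \<open>facet_sign_kempe\<close>. Expanded, it is the sum of
    \<open>\<omega>\<close> over the corners minus the sum of \<open>e\<close> over the
    sides.\<close>
  define m where "m u v w =
    \<omega> u * (1 - \<delta> v - \<delta> w) + \<omega> v * (1 - \<delta> w - \<delta> u) + \<omega> w * (1 - \<delta> u - \<delta> v)" for u v w
  define e where "e u v = \<omega> u * \<delta> v + \<omega> v * \<delta> u" for u v
  have in_W: "v \<in> W \<Longrightarrow> f v \<in> {a, b}" for v using W by (auto simp: bicolored_def)
  have same: "(u \<in> W) = (v \<in> W)" if "{f u, f v} = {a, b}" "u \<in> ?V" "v \<in> ?V" "{u, v} \<in> edges r s" for u v
  proof -
    have "f u \<in> {a, b}" "f v \<in> {a, b}" using that(1) by blast+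
    then have "u \<in> bicolored ?V f a b" "v \<in> bicolored ?V f a b"
      using that by (auto simp: bicolored_def)
    moreover have "{v, u} \<in> edges r s" using that(4) by (simp add: insert_commute)
    ultimately show ?thesis using closed that(4) by blast
  qed
  have tri: "[?s (f u, f v, f w) - ?s (?g u, ?g v, ?g w) = 2 * m u v w] (mod 4)"
    if V: "u \<in> ?V" "v \<in> ?V" "w \<in> ?V" and E: "{u, v} \<in> edges r s" "{v, w} \<in> edges r s" "{u, w} \<in> edges r s"
    for u v w
  proof -
    have "{f u, f v, f w} \<subseteq> {p, q, t, d}"
      using V four_coloring_range[OF f] unfolding all by blast
    moreover have "distinct [f u, f v, f w]"
      using E proper_coloring_neq[OF f] by simp
    ultimately show ?thesis
      using facet_sign_kempe[OF dist _ _ pqt ab(3), of "f u" "f v" "f w" "u \<in> W" "v \<in> W" "w \<in> W",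
          OF _ _ in_W in_W in_W same[OF _ V(1,2) E(1)] same[OF _ V(2,3) E(2)] same[OF _ V(1,3) E(3)]]
      unfolding m_def \<omega>_def \<delta>_def swap_colors_def by blast
  qed
  define H where "H v = e v (?t 1 0 v)" for v
  define U where "U v = e v (?t 0 1 v)" for v
  have m_e: "m v (?t 1 0 v) (?t 1 1 v) + m v (?t 1 1 v) (?t 0 1 v) =
      (2 * \<omega> v + 2 * \<omega> (?t 1 1 v) + \<omega> (?t 1 0 v) + \<omega> (?t 0 1 v)) -
      (H v + U (?t 1 0 v) + 2 * e v (?t 1 1 v) + H (?t 0 1 v) + U v)" for v
    unfolding m_def H_def U_def e_def translate_translate by (simp add: algebra_simps)
  \<comment> \<open>Each vertex is a corner of six triangles and each edge a side of two, so every
    term occurs an even number of times.\<close>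
  have "(\<Sum>v\<in>?V. m v (?t 1 0 v) (?t 1 1 v) + m v (?t 1 1 v) (?t 0 1 v)) =
      2 * (3 * (\<Sum>v\<in>?V. \<omega> v) - (\<Sum>v\<in>?V. H v) - (\<Sum>v\<in>?V. U v) - (\<Sum>v\<in>?V. e v (?t 1 1 v)))"
    unfolding m_e sum.distrib sum_subtractf sum_distrib_left[symmetric]
      sum_translate[OF pos, of \<omega>] sum_translate[OF pos, of H] sum_translate[OF pos, of U]
    by simp
  then have even: "4 dvd 2 * (\<Sum>v\<in>?V. m v (?t 1 0 v) (?t 1 1 v) + m v (?t 1 1 v) (?t 0 1 v))"
    by simp
  have "[coloring_degree r s f - coloring_degree r s ?g =
      (\<Sum>v\<in>?V. 2 * (m v (?t 1 0 v) (?t 1 1 v) + m v (?t 1 1 v) (?t 0 1 v)))] (mod 4)"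
    unfolding coloring_degree_sum[OF rs f \<tau>] coloring_degree_sum[OF rs g \<tau>] sum_subtractf[symmetric]
  proof (rule cong_sum)
    fix v assume v: "v \<in> ?V"
    note E = translate_edges[OF pos v]
    have "{?t 1 1 v, ?t 0 1 v} \<in> edges r s" using E(5) by (simp add: insert_commute)
    with E v have "[(?s (f v, f (?t 1 0 v), f (?t 1 1 v)) - ?s (?g v, ?g (?t 1 0 v), ?g (?t 1 1 v))) +
        (?s (f v, f (?t 1 1 v), f (?t 0 1 v)) - ?s (?g v, ?g (?t 1 1 v), ?g (?t 0 1 v))) =
        2 * m v (?t 1 0 v) (?t 1 1 v) + 2 * m v (?t 1 1 v) (?t 0 1 v)] (mod 4)"
      by (intro cong_add tri translate_in_vertices pos)
    then show "[?s (f v, f (?t 1 0 v), f (?t 1 1 v)) + ?s (f v, f (?t 1 1 v), f (?t 0 1 v)) -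
        (?s (?g v, ?g (?t 1 0 v), ?g (?t 1 1 v)) + ?s (?g v, ?g (?t 1 1 v), ?g (?t 0 1 v))) =
        2 * (m v (?t 1 0 v) (?t 1 1 v) + m v (?t 1 1 v) (?t 0 1 v))] (mod 4)"
      by (simp only: algebra_simps)
  qed
  moreover have "[(\<Sum>v\<in>?V. 2 * (m v (?t 1 0 v) (?t 1 1 v) + m v (?t 1 1 v) (?t 0 1 v))) = 0] (mod 4)"
    unfolding sum_distrib_left[symmetric] cong_0_iff by (rule even)
  ultimately have "[coloring_degree r s f - coloring_degree r s ?g = 0] (mod 4)"
    by (rule cong_trans)
  then show ?thesis unfolding cong_diff_iff_cong_0 by (rule cong_sym)
qed

section \<open>Non-ergodicity\<close>

text \<open>Stated for an arbitrary set of components, so that it covers every outcome of the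
  coins.\<close>

lemma components_closed:
  assumes C: "\<C> \<subseteq> connected_components E B"
  shows "\<Union>\<C> \<subseteq> B" and "{u, v} \<in> E \<Longrightarrow> u \<in> \<Union>\<C> \<Longrightarrow> v \<in> B \<Longrightarrow> v \<in> \<Union>\<C>"
proof -
  let ?R = "{(u, v). u \<in> B \<and> v \<in> B \<and> {u, v} \<in> E}"
  have sub: "X \<subseteq> B" if X: "X \<in> \<C>" for X
  proof -
    obtain z where "z \<in> B" "X = ?R\<^sup>* `` {z}"
      using C X unfolding connected_components_def by (auto elim: quotientE)
    moreover have "y \<in> B" if "(z, y) \<in> ?R\<^sup>*" "z \<in> B" for y
      using that by (induction rule: rtrancl_induct) auto
    ultimately show ?thesis by blast
  qed
  then show "\<Union>\<C> \<subseteq> B" by blast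
  assume uv: "{u, v} \<in> E" "u \<in> \<Union>\<C>" "v \<in> B"
  then obtain X where X: "X \<in> \<C>" "u \<in> X" by blast
  then obtain z where z: "X = ?R\<^sup>* `` {z}"
    using C unfolding connected_components_def by (auto elim: quotientE)
  have "(u, v) \<in> ?R" using uv X sub[OF X(1)] by blast
  then have "v \<in> X" using X(2) unfolding z by (auto intro: rtrancl_into_rtrancl)
  then show "v \<in> \<Union>\<C>" using X by blast
qed

text \<open>Modulo 3 both degrees are 0, modulo 4 they agree by the Kempe argument, and 3 and 4 are
  coprime. Membership is included so that the claim can be iterated.\<close>

lemma wsk_step_degree:
  assumes "3 dvd r" "3 dvd s" "r > 0" "s > 0" and f: "f \<in> four_colorings r s"
    and g: "g \<in> set_pmf (wsk_step 4 (vertices r s) (edges r s) f)"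
  shows "g \<in> four_colorings r s \<and> [coloring_degree r s g = coloring_degree r s f] (mod 12)"
proof -
  let ?V = "vertices r s" and ?E = "edges r s"
  let ?A = "{(a, b). a \<in> {1..4::nat} \<and> b \<in> {1..4} \<and> a \<noteq> b}"
  have rs: "r \<ge> 2" "s \<ge> 2" using assms by (auto simp: dvd_def)
  have "finite ?A" by (rule finite_subset[of _ "{1..4} \<times> {1..4}"]) auto
  moreover have "(1, 2) \<in> ?A" by simp
  ultimately have set: "set_pmf (pmf_of_set ?A) = ?A" by (intro set_pmf_of_set) blast+
  obtain a b flip where ab: "(a, b) \<in> ?A"
    and g_eq: "g = swap_colors a b (\<Union>{C \<in> connected_components ?E (bicolored ?V f a b). flip C}) f"
    using g unfolding wsk_step_def set_bind_pmf set Let_def set_return_pmf by (auto simp del: atLeastAtMost_iff)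
  define \<C> where "\<C> = {C \<in> connected_components ?E (bicolored ?V f a b). flip C}"
  have "\<C> \<subseteq> connected_components ?E (bicolored ?V f a b)" by (auto simp: \<C>_def)
  note closed = components_closed[OF this]
  have ab: "a \<in> {1..4}" "b \<in> {1..4}" "a \<noteq> b" using ab by auto
  have g_eq: "g = swap_colors a b (\<Union>\<C>) f" using g_eq by (simp add: \<C>_def)
  have g4: "g \<in> four_colorings r s"
    unfolding g_eq by (rule swap_colors_proper[OF f ab(1,2) closed(1) closed(2) edges_subset[OF assms(3,4)]])
  have "[coloring_degree r s g = coloring_degree r s f] (mod 4)"
    unfolding g_eq by (rule kempe_degree_mod_4[OF rs f g4[unfolded g_eq] ab closed])
  moreover have "[coloring_degree r s g = coloring_degree r s f] (mod 3)"
    using degree_cong_0_mod_3[OF assms(1-4)] f g4 by (metis cong_sym cong_trans)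
  ultimately have "[coloring_degree r s g = coloring_degree r s f] (mod 12)"
    unfolding cong_iff_dvd_diff by presburger
  then show ?thesis using g4 by simp
qed

lemma steps_invariant:
  assumes "P x" and "\<And>y z. P y \<Longrightarrow> z \<in> set_pmf (K y) \<Longrightarrow> P z" and "y \<in> set_pmf (steps K n x)"
  shows "P y"
  using assms(3)
proof (induction n arbitrary: y)
  case 0
  then show ?case using assms(1) by (simp add: steps_def)
next
  case (Suc n)
  then obtain z where "z \<in> set_pmf (steps K n x)" "y \<in> set_pmf (K z)" by (auto simp: steps_def)
  then show ?case using Suc.IH assms(2) by blast
qed

lemma wsk_not_ergodic:
  assumes "3 dvd r" "3 dvd s" "r > 0" "s > 0"
    and f: "f \<in> four_colorings r s" and deg: "\<not> [coloring_degree r s f = 0] (mod 12)"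
  shows "\<not> wsk_ergodic 4 (vertices r s) (edges r s)"
proof
  assume erg: "wsk_ergodic 4 (vertices r s) (edges r s)"
  let ?V = "vertices r s" and ?K = "wsk_step 4 (vertices r s) (edges r s)"
  \<comment> \<open>The three edge directions shift \<open>x + y\<close> by 1, 1 and 2, none
    divisible by 3. The added 1 moves the residues into the color range.\<close>
  define g where "g = (\<lambda>v\<in>?V. nat ((fst v + snd v) mod 3) + 1)"
  have trans: "(fst (translate r s i j v) + snd (translate r s i j v)) mod 3 =
      (fst v + snd v + (i + j)) mod 3" for i j v
    using translate_cong[OF assms(1,2)] by (simp add: cong_def)
  have neq: "g v \<noteq> g (translate r s i j v)" if "v \<in> ?V" "i + j \<in> {1, 2}" for v i j
  proof -
    have "(fst v + snd v) mod 3 \<noteq> (fst v + snd v + (i + j)) mod 3"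
      using that(2) by (elim insertE emptyE) presburger+
    then show ?thesis
      using that(1) translate_in_vertices[OF assms(3,4)] by (simp add: g_def trans nat_eq_iff)
  qed
  have g_ne: "g u \<noteq> g v" if "{u, v} \<in> edges r s" for u v
  proof -
    obtain x where "x \<in> ?V" "{u, v} = {x, translate r s 1 0 x} \<or>
        {u, v} = {x, translate r s 0 1 x} \<or> {u, v} = {x, translate r s 1 1 x}"
      using \<open>{u, v} \<in> edges r s\<close> unfolding edges_def by blast
    then show ?thesis
      using neq[of x 1 0] neq[of x 0 1] neq[of x 1 1] by (auto simp: doubleton_eq_iff)
  qed
  have g_range: "g v \<in> {1..3}" if "v \<in> ?V" for v
  proof -
    have "0 \<le> (fst v + snd v) mod 3" "(fst v + snd v) mod 3 < 3" by simp_all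
    then show ?thesis using that by (simp add: g_def)
  qed
  have g4: "g \<in> four_colorings r s"
    using g_ne g_range by (force simp: proper_colorings_def g_def)
  have rs: "r \<ge> 2" "s \<ge> 2" using assms by (auto simp: dvd_def)
  have "facet_sign (2, 3, 4) (g u, g v, g w) = 0" if "u \<in> ?V" "v \<in> ?V" "w \<in> ?V" for u v w
  proof -
    have "g u \<noteq> 4" "g v \<noteq> 4" "g w \<noteq> 4" using g_range that by fastforce+
    then show ?thesis by (simp add: facet_sign_def)
  qed
  then have deg_g: "coloring_degree r s g = 0"
    unfolding coloring_degree_sum[OF rs g4, of "(2, 3, 4)", unfolded facets_def, simplified]
    by (intro sum.neutral) (simp add: translate_in_vertices assms(3,4))
  obtain n where "f \<in> set_pmf (steps ?K n g)"
    using erg f g4 unfolding wsk_ergodic_def irreducible_chain_def by (auto simp: set_pmf_iff less_le)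
  from steps_invariant[where P = "\<lambda>h. h \<in> four_colorings r s \<and> [coloring_degree r s h = 0] (mod 12)",
      OF _ _ this]
  have "[coloring_degree r s f = 0] (mod 12)"
    using wsk_step_degree[OF assms(1-4)] g4 deg_g by (metis cong_refl cong_trans)
  with deg show False ..
qed

section \<open>A coloring of degree six\<close>

text \<open>The first nine rows and columns of the table form a four-coloring of \<open>T(9, 9)\<close> of degree six.
  The columns 0, 9, 10 can be inserted cyclically any number of times after column 8 without
  changing the degree, and likewise for the rows.\<close>

definition table :: "nat list list" where
  "table =
  [[1, 2, 4, 2, 1, 3, 4, 2, 3, 2, 4],
   [2, 4, 3, 1, 3, 4, 2, 3, 1, 4, 1],
   [4, 3, 1, 2, 4, 2, 3, 1, 2, 3, 2],
   [3, 1, 2, 4, 3, 1, 4, 2, 4, 1, 4],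
   [1, 2, 4, 3, 1, 4, 2, 1, 3, 2, 3],
   [2, 4, 3, 1, 2, 3, 1, 3, 4, 3, 4],
   [1, 3, 1, 2, 3, 1, 2, 4, 2, 4, 2],
   [3, 4, 2, 3, 4, 2, 4, 3, 1, 2, 1],
   [4, 1, 3, 4, 2, 1, 3, 1, 2, 1, 3],
   [2, 4, 3, 1, 4, 2, 1, 3, 1, 4, 1],
   [4, 3, 1, 4, 2, 1, 3, 4, 2, 1, 2]]"

definition table_color :: "nat \<Rightarrow> nat \<Rightarrow> nat" where
  "table_color i j = table ! i ! j"

text \<open>After one pass through 0 to 8 the labels cycle through 0, 9, 10. As 9 is a multiple of
  3, position 9 has label 0, as if the pass had closed up.\<close>

definition table_index :: "int \<Rightarrow> nat" where
  "table_index n = (if n < 9 then nat n else [0, 9, 10] ! nat (n mod 3))"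

text \<open>A cell of the torus depends only on a row step and a column step. Both walks are closed
  at 0 and can therefore be concatenated.\<close>

definition base_steps :: "(nat \<times> nat) list" where
  "base_steps = [(0, 1), (1, 2), (2, 3), (3, 4), (4, 5), (5, 6), (6, 7), (7, 8), (8, 0)]"

definition loop_steps :: "(nat \<times> nat) list" where
  "loop_steps = [(0, 9), (9, 10), (10, 0)]"

lemma table_index_step:
  assumes "n \<ge> 0"
  shows "(table_index n, table_index (n + 1)) \<in> set (base_steps @ loop_steps)"
proof (cases "n < 9")
  case True
  then have "n \<in> {0, 1, 2, 3, 4, 5, 6, 7, 8}" using assms by auto
  then show ?thesis
    by (elim insertE emptyE) (simp_all add: table_index_def base_steps_def)
next
  case False
  have "n mod 3 \<in> {0, 1, 2}" by auto
  moreover have "(n + 1) mod 3 = (n mod 3 + 1) mod 3" by (simp add: mod_simps)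
  ultimately show ?thesis
    using False by (elim insertE emptyE) (simp_all add: table_index_def loop_steps_def)
qed

text \<open>Position \<open>3 * L\<close> is a multiple of 3 and at least 9, so it has label 0, like
  position 0.\<close>

lemma table_index_wrap:
  assumes "L \<ge> 3" "n \<in> {0..<3 * L}"
  shows "table_index ((n + 1) mod (3 * L)) = table_index (n + 1)"
proof (cases "n + 1 < 3 * L")
  case False
  then have "n + 1 = 3 * L" using assms by auto
  then show ?thesis using assms by (simp add: table_index_def)
qed (use assms in simp)

text \<open>Raising \<open>L\<close> by one appends exactly one traversal of the loop. Used in both
  directions, it reduces the degree to four finite sums.\<close>

lemma sum_table_index:
  fixes g :: "nat \<Rightarrow> nat \<Rightarrow> int"
  assumes "L \<ge> 3"
  shows "(\<Sum>n\<in>{0..<3 * L}. g (table_index n) (table_index (n + 1))) =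
    (\<Sum>(i, j)\<leftarrow>base_steps. g i j) + (L - 3) * (\<Sum>(i, j)\<leftarrow>loop_steps. g i j)"
  using assms
proof (induction L rule: int_ge_induct)
  case base
  have "{0..<3 * 3} = {0, 1, 2, 3, 4, 5, 6, 7, 8 :: int}" by auto
  then show ?case by (simp add: table_index_def base_steps_def)
next
  case (step L)
  have "{0..<3 * (L + 1)} = {0..<3 * L} \<union> {3 * L, 3 * L + 1, 3 * L + 2}" using step.hyps by auto
  moreover have "{0..<3 * L} \<inter> {3 * L, 3 * L + 1, 3 * L + 2} = {}" by auto
  ultimately have "(\<Sum>n\<in>{0..<3 * (L + 1)}. g (table_index n) (table_index (n + 1))) =
      (\<Sum>n\<in>{0..<3 * L}. g (table_index n) (table_index (n + 1))) +
      (\<Sum>n\<in>{3 * L, 3 * L + 1, 3 * L + 2}. g (table_index n) (table_index (n + 1)))"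
    by (simp only:) (rule sum.union_disjoint; simp)
  moreover have "table_index (3 * L) = 0" "table_index (3 * L + 1) = 9"
    "table_index (3 * L + 2) = 10" "table_index (3 * L + 3) = 0"
    using step.hyps by (simp_all add: table_index_def)
  then have "(\<Sum>n\<in>{3 * L, 3 * L + 1, 3 * L + 2}. g (table_index n) (table_index (n + 1))) =
      (\<Sum>(i, j)\<leftarrow>loop_steps. g i j)"
    by (simp add: loop_steps_def add.assoc)
  ultimately show ?case using step.IH by (simp add: algebra_simps)
qed

text \<open>This finite check covers all side lengths, because only these pairs of steps ever
  occur.\<close>

lemma table_proper:
  "\<forall>(i, i') \<in> set (base_steps @ loop_steps). \<forall>(j, j') \<in> set (base_steps @ loop_steps).
    table_color i j \<in> {1, 2, 3, 4} \<and> table_color i j \<noteq> table_color i' j \<and>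
    table_color i j \<noteq> table_color i j' \<and> table_color i j \<noteq> table_color i' j'"
  by code_simp

definition cell_sign :: "nat \<Rightarrow> nat \<Rightarrow> nat \<Rightarrow> nat \<Rightarrow> int" where
  "cell_sign i i' j j' =
    facet_sign (2, 3, 4) (table_color i j, table_color i' j, table_color i' j') +
    facet_sign (2, 3, 4) (table_color i j, table_color i' j', table_color i j')"

text \<open>Each product of two closed walks is itself a colored torus, and these are the four
  degrees. The zeros make the degree independent of how often the loops are inserted.\<close>

lemma sum_cell_sign:
  "(\<Sum>(i, i')\<leftarrow>base_steps. \<Sum>(j, j')\<leftarrow>base_steps. cell_sign i i' j j') = 6"
  "(\<Sum>(i, i')\<leftarrow>base_steps. \<Sum>(j, j')\<leftarrow>loop_steps. cell_sign i i' j j') = 0"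
  "(\<Sum>(i, i')\<leftarrow>loop_steps. \<Sum>(j, j')\<leftarrow>base_steps. cell_sign i i' j j') = 0"
  "(\<Sum>(i, i')\<leftarrow>loop_steps. \<Sum>(j, j')\<leftarrow>loop_steps. cell_sign i i' j j') = 0"
  by code_simp+

lemma exists_degree_6:
  assumes L: "L \<ge> 3" and M: "M \<ge> 3"
  obtains f where "f \<in> four_colorings (3 * L) (3 * M)" "coloring_degree (3 * L) (3 * M) f = 6"
proof
  let ?V = "vertices (3 * L) (3 * M)" and ?E = "edges (3 * L) (3 * M)" and ?t = "translate (3 * L) (3 * M)"
  define f where "f = (\<lambda>v\<in>?V. table_color (table_index (fst v)) (table_index (snd v)))"
  have pos: "3 * L > 0" "3 * M > 0" "3 * L \<ge> 2" "3 * M \<ge> 2" using L M by auto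
  have f: "f v = table_color (table_index (fst v)) (table_index (snd v))"
    "f (?t 1 0 v) = table_color (table_index (fst v + 1)) (table_index (snd v))"
    "f (?t 0 1 v) = table_color (table_index (fst v)) (table_index (snd v + 1))"
    "f (?t 1 1 v) = table_color (table_index (fst v + 1)) (table_index (snd v + 1))"
    if "v \<in> ?V" for v
  proof -
    have "fst v \<in> {0..<3 * L}" "snd v \<in> {0..<3 * M}" using that by (auto simp: vertices_def)
    then show "f v = table_color (table_index (fst v)) (table_index (snd v))"
      "f (?t 1 0 v) = table_color (table_index (fst v + 1)) (table_index (snd v))"
      "f (?t 0 1 v) = table_color (table_index (fst v)) (table_index (snd v + 1))"
      "f (?t 1 1 v) = table_color (table_index (fst v + 1)) (table_index (snd v + 1))"
      using that translate_in_vertices[OF pos(1,2)] table_index_wrap[OF L] table_index_wrap[OF M]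
      by (simp_all add: f_def) (simp_all add: translate_def)
  qed
  have ok: "f v \<in> {1, 2, 3, 4} \<and> f v \<noteq> f (?t 1 0 v) \<and> f v \<noteq> f (?t 0 1 v) \<and> f v \<noteq> f (?t 1 1 v)"
    if v: "v \<in> ?V" for v
  proof -
    have "0 \<le> fst v" "0 \<le> snd v" using v by (auto simp: vertices_def)
    from table_index_step[OF this(1)] table_index_step[OF this(2)] table_proper
    show ?thesis unfolding f[OF v] by blast
  qed
  have "f u \<noteq> f v" if uv: "{u, v} \<in> ?E" for u v
  proof -
    obtain x where "x \<in> ?V" "{u, v} = {x, ?t 1 0 x} \<or> {u, v} = {x, ?t 0 1 x} \<or> {u, v} = {x, ?t 1 1 x}"
      using uv unfolding edges_def by blast
    then show ?thesis using ok[of x] by (auto simp: doubleton_eq_iff)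
  qed
  moreover have "f v \<in> {1..4}" if "v \<in> ?V" for v using ok[OF that] by auto
  ultimately show f4: "f \<in> four_colorings (3 * L) (3 * M)"
    by (auto simp: proper_colorings_def f_def)
  let ?i = table_index
  have "coloring_degree (3 * L) (3 * M) f =
      (\<Sum>v\<in>?V. cell_sign (?i (fst v)) (?i (fst v + 1)) (?i (snd v)) (?i (snd v + 1)))"
    unfolding coloring_degree_sum[OF pos(3,4) f4, of "(2, 3, 4)", unfolded facets_def, simplified]
    by (intro sum.cong refl) (simp only: f cell_sign_def)
  also have "\<dots> = (\<Sum>x\<in>{0..<3 * L}. \<Sum>y\<in>{0..<3 * M}.
      cell_sign (?i x) (?i (x + 1)) (?i y) (?i (y + 1)))"
    unfolding vertices_def sum.cartesian_product by (simp add: case_prod_beta)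
  also have "\<dots> = 6"
    unfolding sum_table_index[OF M] sum.distrib sum_distrib_left[symmetric]
      sum_table_index[OF L, of "\<lambda>i i'. \<Sum>(j, j')\<leftarrow>base_steps. cell_sign i i' j j'"]
      sum_table_index[OF L, of "\<lambda>i i'. \<Sum>(j, j')\<leftarrow>loop_steps. cell_sign i i' j j'"]
      sum_cell_sign by simp
  finally show "coloring_degree (3 * L) (3 * M) f = 6" .
qed

theorem theorem5p4:
  fixes L M :: int
  assumes "L \<ge> 3" and "M \<ge> L"
  shows "(\<exists>f \<in> four_colorings (3 * L) (3 * M). [coloring_degree (3 * L) (3 * M) f = 6] (mod 12)) \<and>
    \<not> wsk_ergodic 4 (vertices (3 * L) (3 * M)) (edges (3 * L) (3 * M))"
proof -
  obtain f where f: "f \<in> four_colorings (3 * L) (3 * M)" "coloring_degree (3 * L) (3 * M) f = 6"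
    using exists_degree_6[of L M] assms by auto
  then have "\<not> wsk_ergodic 4 (vertices (3 * L) (3 * M)) (edges (3 * L) (3 * M))"
    using assms by (intro wsk_not_ergodic[where f = f]) (auto simp: cong_def)
  with f show ?thesis by (metis cong_refl)
qed

end
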